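(* Let $n=2p+1\geq 3$ be odd and let $G$ be a connected graph on $n$ vertices, with Randić matrix $R$, that has no suspended paths and satisfies $\operatorname{null}(R)\geq 1$. Then $RE(G)<RE(S^p)$, where $S^p$ is the $p$-sun.
   Context: Graphs are finite, simple and undirected. For a graph $G$ with vertex set $V$, edge set $E$ and vertex degrees $d_u$, the Randić matrix $R=[r_{uv}]$ is the real symmetric matrix indexed by $V$ with $r_{uv}=1/\sqrt{d_ud_v}$ if $uv\in E$ and $r_{uv}=0$ otherwise. The Randić energy is $RE(G)=\sum_{i=1}^n|\lambda_i|$, where $\lambda_1,\dots,\lambda_n$ are the eigenvalues of $R$ with multiplicity. $\operatorname{null}(R)$ denotes the dimension of the null space of $R$. A suspended path is a path $uvw$ in $G$ with $d_u=1$ and $d_v=2$ (i.e. $u$ is a pendent vertex whose neighbor has degree $2$). The $p$-sun $S^p$ is the tree of order $2p+1$ obtained from the star on $p+1$ vertices (one center joined to $p$ leaves) by subdividing each edge once. *)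

theory Defs
  imports
    "Graph_Theory.Graph_Theory"
    "Jordan_Normal_Form.Spectral_Radius"
    "Jordan_Normal_Form.Matrix_Kernel"
begin

text \<open>
  A finite simple undirected graph is a \<^locale>\<open>pair_graph\<close>: a finite loopfree digraph without
  parallel arcs whose arc relation is symmetric, each edge uv being the two arcs (u,v) and (v,u).
  Hence the degree of a vertex is its out-degree.
\<close>

abbreviation vdegree :: "'a pair_pre_digraph \<Rightarrow> 'a \<Rightarrow> nat" where
  "vdegree G u \<equiv> out_degree (with_proj G) u"

text \<open>
  Matrices are indexed by {0..<n}, so the vertices have to be enumerated. A different enumeration
  conjugates the matrix by a permutation matrix, so that the characteristic polynomial, the spectrum
  and the dimension of the kernel do not depend on the choice.
\<close>

definition vertex_list :: "'a pair_pre_digraph \<Rightarrow> 'a list" where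
  "vertex_list G = (SOME vs. distinct vs \<and> set vs = pverts G)"

definition randic_entry :: "'a pair_pre_digraph \<Rightarrow> 'a \<Rightarrow> 'a \<Rightarrow> real" where
  "randic_entry G u v =
     (if (u, v) \<in> parcs G then 1 / sqrt (real (vdegree G u) * real (vdegree G v)) else 0)"

definition randic_matrix :: "'a pair_pre_digraph \<Rightarrow> real mat" where
  "randic_matrix G = mat (card (pverts G)) (card (pverts G))
     (\<lambda>(i, j). randic_entry G (vertex_list G ! i) (vertex_list G ! j))"

text \<open>
  The matrix is real symmetric, so its real spectrum contains all of its eigenvalues. Each is
  counted with its multiplicity as a root of the characteristic polynomial.
\<close>

definition randic_energy :: "'a pair_pre_digraph \<Rightarrow> real" where
  "randic_energy G = (\<Sum>\<mu>\<in>spectrum (randic_matrix G).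
     real (Polynomial.order \<mu> (char_poly (randic_matrix G))) * \<bar>\<mu>\<bar>)"

definition suspended_path :: "'a pair_pre_digraph \<Rightarrow> 'a \<Rightarrow> 'a \<Rightarrow> 'a \<Rightarrow> bool" where
  "suspended_path G u v w \<longleftrightarrow> distinct [u, v, w] \<and> (u, v) \<in> parcs G \<and> (v, w) \<in> parcs G
     \<and> vdegree G u = 1 \<and> vdegree G v = 2"

datatype sun_vertex = Center | Leaf nat | Mid nat

definition star :: "nat \<Rightarrow> sun_vertex pair_pre_digraph" where
  "star p = \<lparr> pverts = insert Center (Leaf ` {..<p}),
     parcs = (\<Union>i<p. {(Center, Leaf i), (Leaf i, Center)}) \<rparr>"

definition sun :: "nat \<Rightarrow> sun_vertex pair_pre_digraph" where
  "sun p = fold (\<lambda>i H. subdivide H (Center, Leaf i) (Mid i)) [0..<p] (star p)"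

lemma vertex_list:
  assumes "finite (pverts G)"
  shows "distinct (vertex_list G)" "set (vertex_list G) = pverts G"
    "length (vertex_list G) = card (pverts G)"
proof -
  have *: "distinct (vertex_list G) \<and> set (vertex_list G) = pverts G"
    unfolding vertex_list_def
    by (rule someI_ex) (use finite_distinct_list[OF assms] in blast)
  then show "distinct (vertex_list G)" "set (vertex_list G) = pverts G" by blast+
  with distinct_card show "length (vertex_list G) = card (pverts G)" by force
qed

lemma sun_partial:
  "k \<le> p \<Longrightarrow> fold (\<lambda>i H. subdivide H (Center, Leaf i) (Mid i)) [0..<k] (star p) =
    \<lparr> pverts = insert Center (Leaf ` {..<p} \<union> Mid ` {..<k}),
      parcs = (\<Union>i<k. {(Center, Mid i), (Mid i, Center), (Mid i, Leaf i), (Leaf i, Mid i)})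
        \<union> (\<Union>i\<in>{k..<p}. {(Center, Leaf i), (Leaf i, Center)}) \<rparr>"
proof (induction k)
  case 0
  then show ?case by (auto simp: star_def)
next
  case (Suc k)
  have "{k..<p} = insert k {Suc k..<p}" using Suc.prems by auto
  with Suc show ?case
    by (simp add: subdivide.simps lessThan_Suc insert_Diff_if) auto
qed

lemma pverts_sun: "pverts (sun p) = insert Center (Leaf ` {..<p} \<union> Mid ` {..<p})"
  and parcs_sun: "parcs (sun p) =
    (\<Union>i<p. {(Center, Mid i), (Mid i, Center), (Mid i, Leaf i), (Leaf i, Mid i)})"
  by (auto simp: sun_def sun_partial)

lemma pair_graph_sun: "pair_graph (sun p)"
  by unfold_locales (auto simp: pverts_sun parcs_sun symmetric_def sym_def)

lemma card_pverts_sun: "card (pverts (sun p)) = 2 * p + 1"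
proof -
  have "card (Leaf ` {..<p} \<union> Mid ` {..<p}) = 2 * p"
    by (subst card_Un_disjoint) (auto simp: card_image inj_on_def)
  moreover have "Center \<notin> Leaf ` {..<p} \<union> Mid ` {..<p}" by auto
  ultimately show ?thesis by (simp add: pverts_sun)
qed

end

theory Submission
  imports Defs
begin

text \<open>
  The Randic matrix \<open>R\<close> is real symmetric, so its characteristic polynomial has \<open>n\<close> real roots, the
  energy is the sum of their absolute values, and the sum of their \<open>k\<close>-th powers is the trace of
  \<open>R\<close> to the power \<open>k\<close>. Both energies are estimated by comparing the absolute value with a
  polynomial; both polynomials touch it at \<open>1 / sqrt 2\<close>, the absolute value of all eigenvalues
  of the sun except \<open>0\<close>, \<open>1\<close> and \<open>-1\<close>.

  Upper bound for \<open>G\<close>. In a connected graph on at least three vertices, the absence of suspended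
  paths means that \<open>d u + d v \<ge> 4\<close> for every edge \<open>uv\<close>, which says exactly that
  \<open>1 / (d u * d v) \<le> (1 / d u + 1 / d v) / 4\<close>. Summing over both orientations of all edges bounds
  the trace of the square of \<open>R\<close> by \<open>n / 2\<close>. As one eigenvalue vanishes, applying
  \<open>\<bar>t\<bar> \<le> t\<^sup>2 / sqrt 2 + 1 / (2 * sqrt 2)\<close> to the other \<open>n - 1\<close> gives
  \<open>RE G \<le> (2 * n - 1) / (2 * sqrt 2) = sqrt 2 * p + sqrt 2 / 4\<close>.

  Lower bound for the sun. Its power sums of order 2 and 4 are \<open>p + 1\<close> and \<open>(p + 3) / 2\<close>, and \<open>1\<close>
  and \<open>-1\<close> are eigenvalues. Keeping these two apart and applying
  \<open>\<bar>t\<bar> \<ge> 3 / sqrt 2 * t\<^sup>2 - sqrt 2 * t ^ 4\<close> to the remaining ones gives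
  \<open>RE (sun p) \<ge> sqrt 2 * p + 2 - sqrt 2\<close>, which is in fact the exact value. The upper bound is
  smaller because \<open>5 * sqrt 2 < 8\<close>.
\<close>

section \<open>Eigenvalues of real symmetric matrices\<close>

text \<open>
  Over the complex numbers the characteristic polynomial splits. If \<open>a\<close> is a root with eigenvector
  \<open>v\<close>, then \<open>a\<close> times the squared norm of \<open>v\<close> is the Hermitian form of \<open>A\<close> at \<open>v\<close>, and symmetry
  makes that form its own conjugate.
\<close>

lemma symmetric_real_eigenvalue_list:
  fixes A :: "real mat"
  assumes A: "A \<in> carrier_mat n n"
    and sym: "\<And>i j. i < n \<Longrightarrow> j < n \<Longrightarrow> A $$ (i, j) = A $$ (j, i)"
  obtains es where "char_poly A = (\<Prod>e\<leftarrow>es. [:- e, 1:])" "length es = n"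
proof -
  define C :: "complex mat" where "C = map_mat of_real A"
  have C: "C \<in> carrier_mat n n" using A by (simp add: C_def)
  have poly: "char_poly C = map_poly of_real (char_poly A)"
    unfolding C_def by (rule of_real_hom.char_poly_hom[OF A])
  obtain as where as: "char_poly C = (\<Prod>a\<leftarrow>as. [:- a, 1:])" "length as = n"
    using char_poly_factorized[OF C] by blast
  have real: "of_real (Re a) = a" if "a \<in> set as" for a
  proof -
    have "poly (char_poly C) a = 0"
      using that by (auto simp: as(1) poly_prod_list prod_list_zero_iff)
    then obtain v where v: "v \<in> carrier_vec n" "v \<noteq> 0\<^sub>v n" "C *\<^sub>v v = a \<cdot>\<^sub>v v"
      using eigenvalue_root_char_poly[OF C] C by (auto simp: eigenvalue_def eigenvector_def)
    define N Q where "N = (\<Sum>i<n. (cmod (v $ i))\<^sup>2)"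
      and "Q = (\<Sum>i<n. \<Sum>j<n. cnj (v $ i) * of_real (A $$ (i, j)) * v $ j)"
    have norm: "cnj z * z = of_real ((cmod z)\<^sup>2)" for z
      by (metis complex_norm_square mult.commute)
    have row: "(\<Sum>j<n. of_real (A $$ (i, j)) * v $ j) = a * v $ i" if "i < n" for i
    proof -
      have "(C *\<^sub>v v) $ i = a * v $ i" using v that by simp
      then show ?thesis using v(1) that A
        by (simp add: C_def mult_mat_vec_def scalar_prod_def lessThan_atLeast0)
    qed
    have "Q = (\<Sum>i<n. cnj (v $ i) * (a * v $ i))"
      unfolding Q_def by (rule sum.cong) (simp_all add: row[symmetric] sum_distrib_left mult.assoc)
    also have "\<dots> = (\<Sum>i<n. a * of_real ((cmod (v $ i))\<^sup>2))"
      by (rule sum.cong) (simp_all only: norm[symmetric] mult.left_commute[of a])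
    also have "\<dots> = a * of_real N"
      by (simp add: N_def sum_distrib_left)
    finally have QN: "Q = a * of_real N" .
    have "cnj Q = (\<Sum>i<n. \<Sum>j<n. v $ i * of_real (A $$ (i, j)) * cnj (v $ j))"
      by (simp add: Q_def)
    also have "\<dots> = (\<Sum>j<n. \<Sum>i<n. v $ i * of_real (A $$ (i, j)) * cnj (v $ j))"
      by (rule sum.swap)
    also have "\<dots> = Q"
      unfolding Q_def by (intro sum.cong) (auto simp: sym)
    finally have "cnj Q = Q" .
    moreover have "N \<noteq> 0"
    proof
      assume "N = 0"
      then have "\<forall>i<n. v $ i = 0" unfolding N_def by (subst (asm) sum_nonneg_eq_0_iff) auto
      with v show False by auto
    qed
    ultimately have "cnj a = a" using QN by simp
    then show ?thesis by (simp add: complex_eq_iff)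
  qed
  interpret of_real_poly: map_poly_inj_idom_hom complex_of_real ..
  have "map (map_poly complex_of_real) (map (\<lambda>e. [:- e, 1:]) (map Re as)) =
      map (\<lambda>a. [:- a, 1:]) as"
    using real by (auto simp: hom_distribs)
  then have "map_poly of_real (char_poly A) = map_poly complex_of_real (\<Prod>e\<leftarrow>map Re as. [:- e, 1:])"
    by (simp only: poly[symmetric] as(1) of_real_poly.hom_prod_list)
  then have "char_poly A = (\<Prod>e\<leftarrow>map Re as. [:- e, 1:])"
    by (simp only: of_real_poly.eq_iff)
  then show thesis using that[of "map Re as"] as(2) by simp
qed

definition mat_trace :: "'a :: comm_monoid_add mat \<Rightarrow> 'a" where
  "mat_trace A = (\<Sum>i<dim_row A. A $$ (i, i))"

lemma mat_mult_entry:
  assumes "A \<in> carrier_mat n m" "B \<in> carrier_mat m k" "i < n" "j < k"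
  shows "(A * B) $$ (i, j) = (\<Sum>l<m. A $$ (i, l) * B $$ (l, j))"
  using assms by (simp add: scalar_prod_def lessThan_atLeast0)

lemma mat_trace_mult_commute:
  fixes A B :: "'a :: comm_semiring_0 mat"
  assumes "A \<in> carrier_mat n n" "B \<in> carrier_mat n n"
  shows "mat_trace (A * B) = mat_trace (B * A)"
proof -
  have "mat_trace (A * B) = (\<Sum>i<n. \<Sum>l<n. A $$ (i, l) * B $$ (l, i))"
    using assms by (simp add: mat_trace_def mat_mult_entry del: index_mult_mat(1))
  also have "\<dots> = (\<Sum>l<n. \<Sum>i<n. A $$ (i, l) * B $$ (l, i))" by (rule sum.swap)
  also have "\<dots> = mat_trace (B * A)"
    using assms by (simp add: mat_trace_def mat_mult_entry mult.commute del: index_mult_mat(1))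
  finally show ?thesis .
qed

lemma upper_triangular_pow_diag:
  fixes B :: "'a :: comm_semiring_1 mat"
  assumes B: "B \<in> carrier_mat n n" "upper_triangular B" and i: "i < n"
  shows "(B ^\<^sub>m k) $$ (i, i) = (B $$ (i, i)) ^ k"
proof -
  have "(\<forall>i<n. \<forall>j<i. (B ^\<^sub>m k) $$ (i, j) = 0) \<and>
    (\<forall>i<n. (B ^\<^sub>m k) $$ (i, i) = (B $$ (i, i)) ^ k)"
  proof (induction k)
    case 0
    then show ?case using B by auto
  next
    case (Suc k)
    have P: "B ^\<^sub>m k \<in> carrier_mat n n" using B by simp
    have tri: "B $$ (l, j) = 0" if "j < l" "l < n" for l j
      using B that by (auto dest: upper_triangularD)
    have entry: "(B ^\<^sub>m Suc k) $$ (i, j) = (\<Sum>l<n. (B ^\<^sub>m k) $$ (i, l) * B $$ (l, j))"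
      if "i < n" "j < n" for i j
      using mat_mult_entry[OF P B(1) that] by simp
    have "(B ^\<^sub>m Suc k) $$ (i, j) = 0" if "i < n" "j < i" for i j
    proof -
      have "(B ^\<^sub>m k) $$ (i, l) * B $$ (l, j) = 0" if "l < n" for l
        using Suc.IH tri[of j l] \<open>i < n\<close> \<open>j < i\<close> that by (cases "l < i") auto
      then show ?thesis using that by (subst entry) auto
    qed
    moreover have "(B ^\<^sub>m Suc k) $$ (i, i) = (B $$ (i, i)) ^ Suc k" if "i < n" for i
    proof -
      have "(B ^\<^sub>m k) $$ (i, l) * B $$ (l, i) = (if l = i then (B $$ (i, i)) ^ Suc k else 0)"
        if "l < n" for l
        using Suc.IH tri[of i l] \<open>i < n\<close> that by (cases l i rule: linorder_cases) (auto simp: mult.commute)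
      then show ?thesis using that by (subst entry) auto
    qed
    ultimately show ?case by blast
  qed
  with i show ?thesis by blast
qed

lemma schur_form:
  fixes A :: "real mat"
  assumes A: "A \<in> carrier_mat n n" and es: "char_poly A = (\<Prod>e\<leftarrow>es. [:- e, 1:])"
  obtains B P Q where "similar_mat_wit A B P Q" "B \<in> carrier_mat n n"
    "upper_triangular B" "diag_mat B = es"
proof -
  obtain B P Q where "schur_decomposition A es = (B, P, Q)"
    by (cases "schur_decomposition A es") auto
  from schur_decomposition[OF A es this] similar_mat_witD2[OF A, of B P Q] that
  show thesis by blast
qed

text \<open>
  The trace is invariant under similarity, and in a Schur form the diagonal of a power consists of
  the powers of the eigenvalues.
\<close>

lemma mat_trace_pow:
  fixes A :: "real mat"
  assumes A: "A \<in> carrier_mat n n" and es: "char_poly A = (\<Prod>e\<leftarrow>es. [:- e, 1:])"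
  shows "mat_trace (A ^\<^sub>m k) = (\<Sum>e\<leftarrow>es. e ^ k)"
proof -
  obtain B P Q where wit: "similar_mat_wit A B P Q" and B: "B \<in> carrier_mat n n"
      "upper_triangular B" "diag_mat B = es"
    using schur_form[OF A es] .
  note D = similar_mat_witD2[OF A wit]
  have Bk: "B ^\<^sub>m k \<in> carrier_mat n n" using B by simp
  have "mat_trace (A ^\<^sub>m k) = mat_trace (P * ((B ^\<^sub>m k) * Q))"
    using similar_mat_wit_pow_id[OF wit, of k] D Bk by (simp add: assoc_mult_mat[of _ n n _ n _ n])
  also have "\<dots> = mat_trace ((B ^\<^sub>m k) * Q * P)"
    using D Bk by (intro mat_trace_mult_commute) auto
  also have "(B ^\<^sub>m k) * Q * P = B ^\<^sub>m k"
    using D Bk by (simp add: assoc_mult_mat[of _ n n _ n _ n])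
  also have "mat_trace (B ^\<^sub>m k) = (\<Sum>i<n. (B $$ (i, i)) ^ k)"
    using B Bk by (simp add: mat_trace_def upper_triangular_pow_diag)
  also have "\<dots> = (\<Sum>e\<leftarrow>es. e ^ k)"
    unfolding B(3)[symmetric] using B(1)
    by (simp add: diag_mat_def o_def interv_sum_list_conv_sum_set_nat lessThan_atLeast0)
  finally show ?thesis .
qed

text \<open>
  A Schur form with nonzero diagonal has trivial kernel, and similar matrices have kernels of the
  same dimension.
\<close>

lemma kernel_dim_imp_zero_eigenvalue:
  fixes A :: "real mat"
  assumes A: "A \<in> carrier_mat n n" and es: "char_poly A = (\<Prod>e\<leftarrow>es. [:- e, 1:])"
    and "kernel_dim A \<ge> 1"
  shows "0 \<in> set es"
proof (rule ccontr)
  assume "0 \<notin> set es"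
  obtain B P Q where wit: "similar_mat_wit A B P Q" and B: "B \<in> carrier_mat n n"
      "upper_triangular B" "diag_mat B = es"
    using schur_form[OF A es] .
  have "kernel.dim n A = 0"
    using similar_mat_wit_kernel_dim[OF A wit] kernel_upper_triangular(1)[OF B(1,2)]
      B(3) \<open>0 \<notin> set es\<close> by simp
  then show False using assms(3) A by (simp add: kernel_dim_def)
qed

lemma eigenvalue_iff_mem:
  fixes A :: "real mat"
  assumes A: "A \<in> carrier_mat n n" and es: "char_poly A = (\<Prod>e\<leftarrow>es. [:- e, 1:])"
  shows "eigenvalue A e \<longleftrightarrow> e \<in> set es"
  by (auto simp: eigenvalue_root_char_poly[OF A] es poly_prod_list prod_list_zero_iff)

lemma order_linear_factors:
  fixes es :: "real list"
  shows "Polynomial.order x (\<Prod>e\<leftarrow>es. [:- e, 1:]) = count_list es x"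
proof -
  have "Polynomial.order x (\<Prod>e\<leftarrow>es. [:- e, 1:]) =
      (\<Sum>e\<leftarrow>es. Polynomial.order x [:- e, 1:])"
    by (subst order_prod_list) (auto simp: o_def)
  also have "\<dots> = count_list es x"
    by (induction es) (auto simp: order_linear')
  finally show ?thesis .
qed

lemma sum_count_list_eq_sum_list:
  fixes f :: "'b \<Rightarrow> real"
  assumes "finite X" "set xs \<subseteq> X"
  shows "(\<Sum>x\<in>X. real (count_list xs x) * f x) = (\<Sum>x\<leftarrow>xs. f x)"
  using assms(2)
proof (induction xs)
  case (Cons a xs)
  have "(\<Sum>x\<in>X. real (count_list (a # xs) x) * f x) =
      (\<Sum>x\<in>X. (if a = x then f x else 0) + real (count_list xs x) * f x)"
    by (rule sum.cong) (auto simp: algebra_simps)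
  with Cons assms(1) show ?case by (simp add: sum.distrib)
qed simp

text \<open>
  This turns the energy, a sum over distinct eigenvalues weighted by multiplicity, into a sum over
  the list of eigenvalues, from which single eigenvalues can be split off.
\<close>

lemma spectrum_sum_eq_sum_list:
  fixes A :: "real mat" and f :: "real \<Rightarrow> real"
  assumes A: "A \<in> carrier_mat n n" and es: "char_poly A = (\<Prod>e\<leftarrow>es. [:- e, 1:])"
  shows "(\<Sum>x\<in>spectrum A. real (Polynomial.order x (char_poly A)) * f x) = (\<Sum>e\<leftarrow>es. f e)"
proof -
  have "spectrum A = set es"
    using eigenvalue_iff_mem[OF A es] by (auto simp: spectrum_def)
  then show ?thesis
    by (simp add: es order_linear_factors sum_count_list_eq_sum_list)
qed

section \<open>The Randic matrix of a graph\<close>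

lemma randic_matrix_carrier: "randic_matrix G \<in> carrier_mat (card (pverts G)) (card (pverts G))"
  by (simp add: randic_matrix_def)

lemma sum_vertex_list:
  assumes "finite (pverts G)"
  shows "(\<Sum>i<card (pverts G). f (vertex_list G ! i)) = (\<Sum>v\<in>pverts G. f v)"
proof (rule sum.reindex_bij_betw)
  show "bij_betw (\<lambda>i. vertex_list G ! i) {..<card (pverts G)} (pverts G)"
    by (rule bij_betw_nth) (simp_all only: vertex_list[OF assms])
qed

lemma sum_sum_vertex_list:
  assumes "finite (pverts G)"
  shows "(\<Sum>i<card (pverts G). \<Sum>j<card (pverts G). f (vertex_list G ! i) (vertex_list G ! j)) =
    (\<Sum>u\<in>pverts G. \<Sum>v\<in>pverts G. f u v)"
proof -
  have "(\<Sum>j<card (pverts G). f u (vertex_list G ! j)) = (\<Sum>v\<in>pverts G. f u v)" for u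
    by (rule sum_vertex_list[OF assms])
  then have "(\<Sum>i<card (pverts G). \<Sum>j<card (pverts G). f (vertex_list G ! i) (vertex_list G ! j)) =
      (\<Sum>i<card (pverts G). \<Sum>v\<in>pverts G. f (vertex_list G ! i) v)"
    by (intro sum.cong refl)
  also have "\<dots> = (\<Sum>u\<in>pverts G. \<Sum>v\<in>pverts G. f u v)"
    by (rule sum_vertex_list[OF assms])
  finally show ?thesis .
qed

lemma randic_matrix_index:
  "i < card (pverts G) \<Longrightarrow> j < card (pverts G) \<Longrightarrow>
    randic_matrix G $$ (i, j) = randic_entry G (vertex_list G ! i) (vertex_list G ! j)"
  by (simp add: randic_matrix_def)

context pair_graph
begin

lemma arc_commute: "(u, v) \<in> parcs G \<longleftrightarrow> (v, u) \<in> parcs G"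
  by (auto intro: arcs_symmetric)

lemma arc_in_verts:
  assumes "(u, v) \<in> parcs G"
  shows "u \<in> pverts G" "v \<in> pverts G"
  using wellformed[OF assms] by simp_all

lemma randic_entry_sym: "randic_entry G u v = randic_entry G v u"
  unfolding randic_entry_def arc_commute[of u v] by (simp add: mult.commute)

lemma randic_eigenvalue_list:
  obtains es where "char_poly (randic_matrix G) = (\<Prod>e\<leftarrow>es. [:- e, 1:])"
    "length es = card (pverts G)" "randic_energy G = (\<Sum>e\<leftarrow>es. \<bar>e\<bar>)"
proof -
  have "randic_matrix G $$ (i, j) = randic_matrix G $$ (j, i)"
    if "i < card (pverts G)" "j < card (pverts G)" for i j
    using that randic_entry_sym by (simp add: randic_matrix_def)
  from symmetric_real_eigenvalue_list[OF randic_matrix_carrier this]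
  obtain es where es: "char_poly (randic_matrix G) = (\<Prod>e\<leftarrow>es. [:- e, 1:])"
    "length es = card (pverts G)" by blast
  from spectrum_sum_eq_sum_list[OF randic_matrix_carrier es(1), of abs]
  have "randic_energy G = (\<Sum>e\<leftarrow>es. \<bar>e\<bar>)" by (simp add: randic_energy_def)
  with es that show thesis by blast
qed

lemma randic_trace_2:
  "mat_trace (randic_matrix G ^\<^sub>m 2) = (\<Sum>u\<in>pverts G. \<Sum>v\<in>pverts G. (randic_entry G u v)\<^sup>2)"
proof -
  let ?n = "card (pverts G)" and ?R = "randic_matrix G" and ?l = "\<lambda>i. vertex_list G ! i"
  note R = randic_matrix_carrier[of G]
  have "mat_trace (?R ^\<^sub>m 2) = (\<Sum>i<?n. (?R * ?R) $$ (i, i))"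
    using R by (simp add: mat_trace_def numeral_2_eq_2)
  also have "\<dots> = (\<Sum>i<?n. \<Sum>j<?n. (randic_entry G (?l i) (?l j))\<^sup>2)"
  proof (rule sum.cong)
    fix i assume "i \<in> {..<?n}"
    then have i: "i < ?n" by simp
    show "(?R * ?R) $$ (i, i) = (\<Sum>j<?n. (randic_entry G (?l i) (?l j))\<^sup>2)"
      unfolding mat_mult_entry[OF R R i i] power2_eq_square
      using i by (intro sum.cong) (simp_all add: randic_matrix_index randic_entry_sym[of _ "?l i"])
  qed simp
  also have "\<dots> = (\<Sum>u\<in>pverts G. \<Sum>v\<in>pverts G. (randic_entry G u v)\<^sup>2)"
    by (rule sum_sum_vertex_list[OF finite_verts])
  finally show ?thesis .
qed

lemma randic_trace_4:
  "mat_trace (randic_matrix G ^\<^sub>m 4) = (\<Sum>u\<in>pverts G. \<Sum>v\<in>pverts G.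
     (\<Sum>w\<in>pverts G. randic_entry G u w * randic_entry G w v)\<^sup>2)"
proof -
  let ?n = "card (pverts G)" and ?R = "randic_matrix G" and ?l = "\<lambda>i. vertex_list G ! i"
  define S where "S u v = (\<Sum>w\<in>pverts G. randic_entry G u w * randic_entry G w v)" for u v
  note R = randic_matrix_carrier[of G]
  have R2: "?R * ?R \<in> carrier_mat ?n ?n" using R by simp
  have S: "(?R * ?R) $$ (i, j) = S (?l i) (?l j)" if "i < ?n" "j < ?n" for i j
    unfolding S_def sum_vertex_list[OF finite_verts, symmetric] mat_mult_entry[OF R R that]
    using that by (simp add: randic_matrix_def)
  have S_sym: "S u v = S v u" for u v
    unfolding S_def by (rule sum.cong) (simp_all add: randic_entry_sym[of u] randic_entry_sym[of v] mult.commute)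
  have "?R ^\<^sub>m 4 = (?R * ?R) * (?R * ?R)"
    using R R2 by (simp add: numeral_eq_Suc assoc_mult_mat[of _ ?n ?n _ ?n _ ?n])
  then have "mat_trace (?R ^\<^sub>m 4) = (\<Sum>i<?n. ((?R * ?R) * (?R * ?R)) $$ (i, i))"
    using R by (simp add: mat_trace_def)
  also have "\<dots> = (\<Sum>i<?n. \<Sum>j<?n. (S (?l i) (?l j))\<^sup>2)"
  proof (rule sum.cong)
    fix i assume "i \<in> {..<?n}"
    then have i: "i < ?n" by simp
    show "((?R * ?R) * (?R * ?R)) $$ (i, i) = (\<Sum>j<?n. (S (?l i) (?l j))\<^sup>2)"
      unfolding mat_mult_entry[OF R2 R2 i i] power2_eq_square
      using i by (intro sum.cong) (simp_all only: S lessThan_iff S_sym[of _ "?l i"])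
  qed simp
  also have "\<dots> = (\<Sum>u\<in>pverts G. \<Sum>v\<in>pverts G. (S u v)\<^sup>2)"
    by (rule sum_sum_vertex_list[OF finite_verts])
  finally show ?thesis unfolding S_def .
qed

lemma randic_eigenvalueI:
  assumes eq: "\<And>u. u \<in> pverts G \<Longrightarrow> (\<Sum>v\<in>pverts G. randic_entry G u v * x v) = e * x u"
    and nz: "w \<in> pverts G" "x w \<noteq> 0"
  shows "eigenvalue (randic_matrix G) e"
proof -
  let ?n = "card (pverts G)" and ?R = "randic_matrix G" and ?l = "\<lambda>i. vertex_list G ! i"
  let ?x = "vec ?n (\<lambda>i. x (?l i))"
  note vl = vertex_list[OF finite_verts]
  have "?R *\<^sub>v ?x = e \<cdot>\<^sub>v ?x"
  proof (rule eq_vecI)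
    fix i assume "i < dim_vec (e \<cdot>\<^sub>v ?x)"
    then have i: "i < ?n" by simp
    then have "?l i \<in> pverts G" using vl by (metis nth_mem)
    have "(?R *\<^sub>v ?x) $ i = (\<Sum>j<?n. randic_entry G (?l i) (?l j) * x (?l j))"
      using i by (simp add: randic_matrix_def scalar_prod_def lessThan_atLeast0)
    also have "\<dots> = (\<Sum>v\<in>pverts G. randic_entry G (?l i) v * x v)"
      by (rule sum_vertex_list[OF finite_verts])
    also have "\<dots> = e * x (?l i)"
      by (rule eq) fact
    finally show "(?R *\<^sub>v ?x) $ i = (e \<cdot>\<^sub>v ?x) $ i"
      using i by simp
  qed (simp add: randic_matrix_def)
  moreover have "?x \<noteq> 0\<^sub>v ?n"
  proof
    obtain i where i: "i < ?n" "?l i = w" using nz(1) vl by (metis in_set_conv_nth)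
    assume "?x = 0\<^sub>v ?n"
    then have "?x $ i = 0" using i by simp
    with i nz(2) show False by simp
  qed
  ultimately show ?thesis
    unfolding eigenvalue_def eigenvector_def by (intro exI[of _ ?x]) (simp add: randic_matrix_def)
qed

text \<open>
  Each vertex that is not isolated receives a total of 1 from its outgoing arcs. An isolated vertex
  receives 0, whence an inequality.
\<close>

lemma sum_arcs_inverse_degree_le:
  "(\<Sum>(u, v)\<in>parcs G. 1 / real (vdegree G u)) \<le> real (card (pverts G))"
proof -
  have "(\<Sum>(u, v)\<in>parcs G. 1 / real (vdegree G u)) =
      (\<Sum>w\<in>pverts G. \<Sum>a\<in>{a \<in> parcs G. fst a = w}. 1 / real (vdegree G (fst a)))"
    unfolding case_prod_beta
    by (rule sum.group[symmetric]) (auto dest: arc_in_verts)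
  also have "\<dots> \<le> (\<Sum>w\<in>pverts G. 1)"
    by (rule sum_mono) (simp add: out_degree_def out_arcs_def)
  finally show ?thesis by simp
qed

lemma randic_trace_2_arcs:
  "mat_trace (randic_matrix G ^\<^sub>m 2) =
    (\<Sum>(u, v)\<in>parcs G. 1 / (real (vdegree G u) * real (vdegree G v)))"
proof -
  have "(\<Sum>u\<in>pverts G. \<Sum>v\<in>pverts G. (randic_entry G u v)\<^sup>2) =
      (\<Sum>(u, v)\<in>pverts G \<times> pverts G. (randic_entry G u v)\<^sup>2)"
    by (simp add: sum.cartesian_product)
  also have "\<dots> = (\<Sum>(u, v)\<in>parcs G. (randic_entry G u v)\<^sup>2)"
    by (rule sum.mono_neutral_right) (auto simp: randic_entry_def split: if_splits dest: arc_in_verts)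
  also have "\<dots> = (\<Sum>(u, v)\<in>parcs G. 1 / (real (vdegree G u) * real (vdegree G v)))"
    by (rule sum.cong) (auto simp: randic_entry_def power_divide)
  finally show ?thesis by (simp add: randic_trace_2)
qed

text \<open>
  The degree condition on an edge \<open>uv\<close> is the inequality \<open>1 / (d u * d v) \<le> (1 / d u + 1 / d v) / 4\<close>
  multiplied by \<open>4 * d u * d v\<close>, so it can be summed arc by arc.
\<close>

lemma randic_trace_2_le:
  assumes deg: "\<And>u v. (u, v) \<in> parcs G \<Longrightarrow> 4 \<le> vdegree G u + vdegree G v"
  shows "mat_trace (randic_matrix G ^\<^sub>m 2) \<le> real (card (pverts G)) / 2"
proof -
  let ?d = "\<lambda>v. real (vdegree G v)"
  have swap: "(\<Sum>(u, v)\<in>parcs G. 1 / ?d v) = (\<Sum>(u, v)\<in>parcs G. 1 / ?d u)"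
    by (rule sum.reindex_bij_witness[of _ prod.swap prod.swap]) (auto simp: arc_commute)
  have "(\<Sum>(u, v)\<in>parcs G. 1 / (?d u * ?d v)) \<le> (\<Sum>(u, v)\<in>parcs G. (1 / ?d u + 1 / ?d v) / 4)"
  proof (rule sum_mono, clarify)
    fix u v assume "(u, v) \<in> parcs G"
    from deg[OF this] have "4 \<le> ?d u + ?d v" by linarith
    then show "1 / (?d u * ?d v) \<le> (1 / ?d u + 1 / ?d v) / 4"
      by (cases "?d u = 0 \<or> ?d v = 0") (auto simp: field_simps)
  qed
  also have "\<dots> = ((\<Sum>(u, v)\<in>parcs G. 1 / ?d u) + (\<Sum>(u, v)\<in>parcs G. 1 / ?d v)) / 4"
    by (simp add: case_prod_beta sum.distrib sum_divide_distrib add_divide_distrib)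
  also have "\<dots> \<le> real (card (pverts G)) / 2"
    using sum_arcs_inverse_degree_le by (simp add: swap)
  finally show ?thesis by (simp add: randic_trace_2_arcs)
qed

lemma vdegree_eq_card_neighbors: "vdegree G u = card {v. (u, v) \<in> parcs G}"
proof -
  have "out_arcs (with_proj G) u = Pair u ` {v. (u, v) \<in> parcs G}"
    by (auto simp: out_arcs_def)
  then show ?thesis by (simp add: out_degree_def card_image inj_on_def)
qed

text \<open>
  A degree sum below 4 requires an end \<open>u\<close> of degree 1. Its neighbor \<open>v\<close> has another neighbor \<open>w\<close>,
  since otherwise \<open>{u, v}\<close> would be a whole component; and if the degree of \<open>v\<close> were 2, then
  \<open>uvw\<close> would be a suspended path.
\<close>

lemma no_suspended_path_degree_sum:
  assumes con: "Digraph_Component.connected (with_proj G)" and n: "card (pverts G) \<ge> 3"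
    and no: "\<not> (\<exists>u v w. suspended_path G u v w)" and arc: "(u, v) \<in> parcs G"
  shows "4 \<le> vdegree G u + vdegree G v"
proof -
  have one: "vdegree G v \<ge> 3" if uv: "(u, v) \<in> parcs G" and u1: "vdegree G u = 1" for u v
  proof -
    obtain a where "{x. (u, x) \<in> parcs G} = {a}"
      using u1 unfolding vdegree_eq_card_neighbors by (rule card_1_singletonE)
    with uv have nu: "{x. (u, x) \<in> parcs G} = {v}" by auto
    have vu: "(v, u) \<in> parcs G" using uv arc_commute by blast
    have "u \<noteq> v" using no_loops[OF uv] by simp
    have "\<exists>w. (v, w) \<in> parcs G \<and> w \<noteq> u"
    proof (rule ccontr)
      assume no_w: "\<nexists>w. (v, w) \<in> parcs G \<and> w \<noteq> u"
      have "pverts G \<subseteq> {u, v}"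
      proof
        fix x assume x: "x \<in> pverts G"
        have "u \<in> pverts G" using uv by (rule arc_in_verts)
        with x con have "(u, x) \<in> rtrancl_on (pverts G) ((parcs G)\<^sup>s)"
          by (auto simp: connected_conv)
        then show "x \<in> {u, v}"
        proof (induction rule: rtrancl_on_induct)
          case (step y z)
          then have "(y, z) \<in> parcs G" using arc_commute[of y z] by (auto simp: symcl_def)
          with step nu no_w show ?case by blast
        qed auto
      qed
      then have "card (pverts G) \<le> card {u, v}" by (intro card_mono) auto
      with n show False using card_insert_le_m1[of 2 "{v}" u] by simp
    qed
    then obtain w where w: "(v, w) \<in> parcs G" "w \<noteq> u" by blast
    from no_loops[OF w(1)] have "v \<noteq> w" by simp
    have fin: "finite {x. (v, x) \<in> parcs G}"
      by (rule finite_subset[of _ "pverts G"]) (auto dest: arc_in_verts)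
    have "card {u, w} \<le> card {x. (v, x) \<in> parcs G}"
      using w vu fin by (intro card_mono) auto
    with w have "vdegree G v \<ge> 2" by (simp add: vdegree_eq_card_neighbors)
    moreover have "vdegree G v \<noteq> 2"
    proof
      assume "vdegree G v = 2"
      then have "suspended_path G u v w"
        using uv w u1 \<open>u \<noteq> v\<close> \<open>v \<noteq> w\<close> by (simp add: suspended_path_def)
      with no show False by blast
    qed
    ultimately show ?thesis by linarith
  qed
  have vu: "(v, u) \<in> parcs G" using arc arc_commute by blast
  have pos: "vdegree G x \<noteq> 0" if "(x, y) \<in> parcs G" for x y
  proof -
    have "finite {y. (x, y) \<in> parcs G}"
      by (rule finite_subset[of _ "pverts G"]) (auto dest: arc_in_verts)
    with that show ?thesis by (auto simp: vdegree_eq_card_neighbors)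
  qed
  from pos[OF arc] pos[OF vu] one[OF arc] one[OF vu] show ?thesis by linarith
qed

end

section \<open>The spectrum of the sun\<close>

lemma sum_sun:
  "(\<Sum>v\<in>pverts (sun p). f v) = f Center + (\<Sum>i<p. f (Leaf i)) + (\<Sum>i<p. f (Mid i))"
proof -
  have "(\<Sum>v\<in>pverts (sun p). f v) = f Center + (\<Sum>v\<in>Leaf ` {..<p} \<union> Mid ` {..<p}. f v)"
    unfolding pverts_sun by (rule sum.insert) auto
  also have "(\<Sum>v\<in>Leaf ` {..<p} \<union> Mid ` {..<p}. f v) =
      (\<Sum>v\<in>Leaf ` {..<p}. f v) + (\<Sum>v\<in>Mid ` {..<p}. f v)"
    by (rule sum.union_disjoint) auto
  also have "(\<Sum>v\<in>Leaf ` {..<p}. f v) = (\<Sum>i<p. f (Leaf i))"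
    by (subst sum.reindex) (auto simp: inj_on_def)
  also have "(\<Sum>v\<in>Mid ` {..<p}. f v) = (\<Sum>i<p. f (Mid i))"
    by (subst sum.reindex) (auto simp: inj_on_def)
  finally show ?thesis by (simp add: add.assoc)
qed

lemma vdegree_sun:
  "vdegree (sun p) Center = p"
  "i < p \<Longrightarrow> vdegree (sun p) (Mid i) = 2"
  "i < p \<Longrightarrow> vdegree (sun p) (Leaf i) = 1"
proof -
  note deg = pair_graph.vdegree_eq_card_neighbors[OF pair_graph_sun]
  have "{v. (Center, v) \<in> parcs (sun p)} = Mid ` {..<p}"
    by (auto simp: parcs_sun)
  then show "vdegree (sun p) Center = p"
    by (simp add: deg card_image inj_on_def)
  assume "i < p"
  then have "{v. (Mid i, v) \<in> parcs (sun p)} = {Center, Leaf i}"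
    and "{v. (Leaf i, v) \<in> parcs (sun p)} = {Mid i}"
    by (auto simp: parcs_sun)
  then show "vdegree (sun p) (Mid i) = 2" "vdegree (sun p) (Leaf i) = 1"
    by (simp_all add: deg)
qed

lemma randic_entry_sun:
  fixes p :: nat
  defines "b \<equiv> 1 / sqrt 2" and "c \<equiv> 1 / sqrt (2 * real p)"
  shows "randic_entry (sun p) Center Center = 0"
    "i < p \<Longrightarrow> randic_entry (sun p) Center (Leaf i) = 0"
    "i < p \<Longrightarrow> randic_entry (sun p) Center (Mid i) = c"
    "i < p \<Longrightarrow> randic_entry (sun p) (Leaf i) Center = 0"
    "i < p \<Longrightarrow> j < p \<Longrightarrow> randic_entry (sun p) (Leaf i) (Leaf j) = 0"
    "i < p \<Longrightarrow> j < p \<Longrightarrow> randic_entry (sun p) (Leaf i) (Mid j) = (if i = j then b else 0)"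
    "i < p \<Longrightarrow> randic_entry (sun p) (Mid i) Center = c"
    "i < p \<Longrightarrow> j < p \<Longrightarrow> randic_entry (sun p) (Mid i) (Leaf j) = (if i = j then b else 0)"
    "i < p \<Longrightarrow> j < p \<Longrightarrow> randic_entry (sun p) (Mid i) (Mid j) = 0"
  unfolding b_def c_def
  by (auto simp: randic_entry_def parcs_sun vdegree_sun mult.commute)

text \<open>
  All computations use only that \<open>b = 1 / sqrt 2\<close> and \<open>c = 1 / sqrt (2 * p)\<close>, the two nonzero
  values of its entries, satisfy \<open>b\<^sup>2 = p * c\<^sup>2 = 1 / 2\<close>.
\<close>

lemma
  assumes p: "p \<ge> 1"
  shows sun_trace_2: "mat_trace (randic_matrix (sun p) ^\<^sub>m 2) = real p + 1"
    and sun_trace_4: "mat_trace (randic_matrix (sun p) ^\<^sub>m 4) = (real p + 3) / 2"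
    and sun_eigenvalue: "s = 1 \<or> s = -1 \<Longrightarrow> eigenvalue (randic_matrix (sun p)) s"
proof -
  interpret pair_graph "sun p" by (rule pair_graph_sun)
  define b c where "b = 1 / sqrt 2" and "c = 1 / sqrt (2 * real p)"
  note r = randic_entry_sun[where p = p, folded b_def c_def]
  have b: "b * b = 1 / 2" and c: "real p * (c * c) = 1 / 2"
    using p by (simp_all add: b_def c_def)
  have pick: "(\<Sum>j<p. if i = j then g j else 0) = g i" "(\<Sum>j<p. if j = i then g j else 0) = g i"
    if "i < p" for i and g :: "nat \<Rightarrow> real"
    using that by simp_all
  have ite: "x * (if P then y else 0) = (if P then x * y else 0)"
      "(if P then y else 0) * x = (if P then y * x else 0)" for x y :: real and P
    by simp_all
  have "(\<Sum>u\<in>pverts (sun p). \<Sum>v\<in>pverts (sun p). (randic_entry (sun p) u v)\<^sup>2) =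
      real p * (c * c) + real p * (b * b) + real p * (c * c + b * b)"
    by (simp add: sum_sun r ite power2_eq_square pick sum.distrib cong: if_cong)
      (simp add: algebra_simps)
  also have "\<dots> = real p + 1" by (simp add: distrib_left b c)
  finally show "mat_trace (randic_matrix (sun p) ^\<^sub>m 2) = real p + 1"
    by (simp add: randic_trace_2)
  define S where "S u v = (\<Sum>w\<in>pverts (sun p). randic_entry (sun p) u w * randic_entry (sun p) w v)"
    for u v
  have S: "S Center Center = 1 / 2"
      "i < p \<Longrightarrow> S Center (Leaf i) = c * b" "i < p \<Longrightarrow> S Center (Mid i) = 0"
      "i < p \<Longrightarrow> S (Leaf i) Center = c * b" "i < p \<Longrightarrow> S (Mid i) Center = 0"
      "i < p \<Longrightarrow> j < p \<Longrightarrow> S (Leaf i) (Leaf j) = (if i = j then 1 / 2 else 0)"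
      "i < p \<Longrightarrow> j < p \<Longrightarrow> S (Leaf i) (Mid j) = 0"
      "i < p \<Longrightarrow> j < p \<Longrightarrow> S (Mid i) (Leaf j) = 0"
      "i < p \<Longrightarrow> j < p \<Longrightarrow> S (Mid i) (Mid j) = c * c + (if i = j then 1 / 2 else 0)"
    for i j
    using b c
    by (simp_all add: S_def sum_sun r ite pick mult.commute cong: if_cong)
  have sq: "(c * c + (if i = j then 1 / 2 else 0))\<^sup>2 =
      (c * c) * (c * c) + (if i = j then c * c + 1 / 4 else 0)" for i j :: nat
    by (simp add: power2_eq_square algebra_simps)
  have "(\<Sum>u\<in>pverts (sun p). \<Sum>v\<in>pverts (sun p). (S u v)\<^sup>2) =
      1 / 4 + 2 * (real p * (c * c)) * (b * b) + real p / 4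
      + (real p * (c * c)) * (real p * (c * c)) + real p * (c * c) + real p / 4"
    by (simp add: sum_sun S sq if_distrib[of "\<lambda>x. x\<^sup>2"] pick sum.distrib cong: if_cong)
      (simp add: power2_eq_square algebra_simps)
  also have "\<dots> = (real p + 3) / 2" unfolding b c by simp
  finally show "mat_trace (randic_matrix (sun p) ^\<^sub>m 4) = (real p + 3) / 2"
    by (simp add: randic_trace_4 S_def)
  assume s: "s = 1 \<or> s = -1"
  \<comment> \<open>Up to scaling, \<open>x\<close> is the vector of square roots of the degrees, which every Randic
    matrix fixes; for \<open>s = -1\<close> it changes sign on the colour class of the center in the bipartition.\<close>
  define x where "x v = (case v of Center \<Rightarrow> s * (real p * c) | Mid i \<Rightarrow> 1 | Leaf i \<Rightarrow> s * b)" for v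
  show "eigenvalue (randic_matrix (sun p)) s"
  proof (rule randic_eigenvalueI)
    show "Mid 0 \<in> pverts (sun p)" "x (Mid 0) \<noteq> 0"
      using p by (auto simp: pverts_sun x_def)
    fix u assume "u \<in> pverts (sun p)"
    then consider "u = Center" | i where "i < p" "u = Leaf i" | i where "i < p" "u = Mid i"
      by (auto simp: pverts_sun)
    then show "(\<Sum>v\<in>pverts (sun p). randic_entry (sun p) u v * x v) = s * x u"
    proof cases
      case 3
      have "(\<Sum>v\<in>pverts (sun p). randic_entry (sun p) u v * x v) = c * (s * (real p * c)) + b * (s * b)"
        using 3 by (simp add: sum_sun r x_def ite pick cong: if_cong)
      also have "\<dots> = s * (real p * (c * c)) + s * (b * b)" by simp
      finally show ?thesis using 3 b c by (simp add: x_def)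
    qed (use s in \<open>auto simp: sum_sun r x_def ite pick cong: if_cong\<close>)
  qed
qed

section \<open>Energy estimates\<close>

text \<open>
  In terms of \<open>u = sqrt 2 * \<bar>t\<bar>\<close>, the polynomials of the next two lemmas are chosen to touch the
  absolute value at \<open>u = 1\<close>. The first, a combination of \<open>t\<^sup>2\<close> and \<open>t ^ 4\<close> alone, also agrees with it at
  0, so that the eigenvalue 0 of the sun costs nothing.
\<close>

lemma abs_ge_quartic: "\<bar>t\<bar> \<ge> 3 / sqrt 2 * t\<^sup>2 - sqrt 2 * t ^ 4" for t :: real
proof -
  define u where "u = sqrt 2 * \<bar>t\<bar>"
  have t: "\<bar>t\<bar> = u / sqrt 2" by (simp add: u_def)
  have "sqrt 2 ^ 4 = (4 :: real)"
    using power_mult[of "sqrt 2 :: real" 2 2] by simp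
  then have powers: "t\<^sup>2 = u\<^sup>2 / 2" "t ^ 4 = u ^ 4 / 4"
    by (simp_all add: u_def power_mult_distrib)
  have "\<bar>t\<bar> - (3 / sqrt 2 * t\<^sup>2 - sqrt 2 * t ^ 4) = u * ((u - 1)\<^sup>2 * (u + 2)) / (2 * sqrt 2)"
    unfolding t powers by (simp add: field_simps power2_eq_square power4_eq_xxxx)
  also have "\<dots> \<ge> 0" by (simp add: u_def)
  finally show ?thesis by simp
qed

lemma abs_le_quadratic: "\<bar>t\<bar> \<le> t\<^sup>2 / sqrt 2 + 1 / (2 * sqrt 2)" for t :: real
proof -
  have "t\<^sup>2 / sqrt 2 + 1 / (2 * sqrt 2) - \<bar>t\<bar> = (sqrt 2 * \<bar>t\<bar> - 1)\<^sup>2 / (2 * sqrt 2)"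
    by (simp add: power2_diff power_mult_distrib field_simps)
  also have "\<dots> \<ge> 0" by simp
  finally show ?thesis by simp
qed

text \<open>
  At \<open>1\<close> and \<open>-1\<close> the quartic bound loses \<open>1 - sqrt 2 / 2\<close> each, and without recovering this loss
  the bound \<open>sqrt 2 * p\<close> would be too weak. Hence these two eigenvalues are split off.
\<close>

lemma randic_energy_sun_ge:
  assumes p: "p \<ge> 1"
  shows "randic_energy (sun p) \<ge> sqrt 2 * real p + 2 - sqrt 2"
proof -
  interpret pair_graph "sun p" by (rule pair_graph_sun)
  obtain es where es: "char_poly (randic_matrix (sun p)) = (\<Prod>e\<leftarrow>es. [:- e, 1:])"
    and energy: "randic_energy (sun p) = (\<Sum>e\<leftarrow>es. \<bar>e\<bar>)"
    using randic_eigenvalue_list .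
  note R = randic_matrix_carrier[of "sun p"]
  define q where "q t = 3 / sqrt 2 * t\<^sup>2 - sqrt 2 * t ^ 4" for t :: real
  define rest where "rest = remove1 (- 1) (remove1 1 es)"
  have "1 \<in> set es" and "- 1 \<in> set es"
    using sun_eigenvalue[OF p] eigenvalue_iff_mem[OF R es] by blast+
  then have split: "(\<Sum>e\<leftarrow>es. f e) = f 1 + f (- 1) + (\<Sum>e\<leftarrow>rest. f e)" for f :: "real \<Rightarrow> real"
    by (simp add: rest_def sum_list_map_remove1[of 1 es] sum_list_map_remove1[of "- 1" "remove1 1 es"])
  have "(\<Sum>e\<leftarrow>es. q e) = 3 / sqrt 2 * (\<Sum>e\<leftarrow>es. e\<^sup>2) - sqrt 2 * (\<Sum>e\<leftarrow>es. e ^ 4)"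
    by (induction es) (simp_all add: q_def algebra_simps)
  also have "\<dots> = sqrt 2 * real p"
    unfolding mat_trace_pow[OF R es, symmetric] sun_trace_2[OF p] sun_trace_4[OF p]
    by (simp add: field_simps)
  finally have "sqrt 2 * real p = q 1 + q (- 1) + (\<Sum>e\<leftarrow>rest. q e)"
    unfolding split by simp
  also have "q 1 + q (- 1) = sqrt 2"
    by (simp add: q_def field_simps)
  also have "(\<Sum>e\<leftarrow>rest. q e) \<le> (\<Sum>e\<leftarrow>rest. \<bar>e\<bar>)"
    by (rule sum_list_mono) (simp only: q_def abs_ge_quartic)
  also have "\<dots> = randic_energy (sun p) - 2"
    unfolding energy split by simp
  finally show ?thesis by simp
qed

text \<open>
  The quadratic bound is positive at 0, so splitting off the eigenvalue 0 saves
  \<open>1 / (2 * sqrt 2)\<close>. Without this saving the estimate would exceed the energy of the sun.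
\<close>

lemma (in pair_graph) randic_energy_le:
  assumes tr: "mat_trace (randic_matrix G ^\<^sub>m 2) \<le> real (card (pverts G)) / 2"
    and ker: "kernel_dim (randic_matrix G) \<ge> 1"
  shows "randic_energy G \<le> (2 * real (card (pverts G)) - 1) / (2 * sqrt 2)"
proof -
  obtain es where es: "char_poly (randic_matrix G) = (\<Prod>e\<leftarrow>es. [:- e, 1:])"
    and len: "length es = card (pverts G)"
    and energy: "randic_energy G = (\<Sum>e\<leftarrow>es. \<bar>e\<bar>)"
    using randic_eigenvalue_list .
  note R = randic_matrix_carrier[of G]
  define rest where "rest = remove1 0 es"
  have zero: "0 \<in> set es" by (rule kernel_dim_imp_zero_eigenvalue[OF R es ker])
  then have split: "(\<Sum>e\<leftarrow>es. f e) = f 0 + (\<Sum>e\<leftarrow>rest. f e)" for f :: "real \<Rightarrow> real"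
    unfolding rest_def by (rule sum_list_map_remove1)
  have len_rest: "real (length rest) = real (card (pverts G)) - 1"
    using zero len length_pos_if_in_set[OF zero] by (simp add: rest_def length_remove1 of_nat_diff)
  have "randic_energy G = (\<Sum>e\<leftarrow>rest. \<bar>e\<bar>)" unfolding energy split by simp
  also have "\<dots> \<le> (\<Sum>e\<leftarrow>rest. e\<^sup>2 / sqrt 2 + 1 / (2 * sqrt 2))"
    by (rule sum_list_mono) (rule abs_le_quadratic)
  also have "\<dots> = (\<Sum>e\<leftarrow>rest. e\<^sup>2) / sqrt 2 + real (length rest) / (2 * sqrt 2)"
    by (induction rest) (simp_all add: add_divide_distrib)
  also have "(\<Sum>e\<leftarrow>rest. e\<^sup>2) = mat_trace (randic_matrix G ^\<^sub>m 2)"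
    unfolding mat_trace_pow[OF R es] split by simp
  also have "mat_trace (randic_matrix G ^\<^sub>m 2) / sqrt 2 + real (length rest) / (2 * sqrt 2)
      \<le> real (card (pverts G)) / 2 / sqrt 2 + (real (card (pverts G)) - 1) / (2 * sqrt 2)"
    unfolding len_rest by (intro add_right_mono divide_right_mono tr) simp
  also have "\<dots> = (2 * real (card (pverts G)) - 1) / (2 * sqrt 2)"
    by (simp add: field_simps)
  finally show ?thesis .
qed

theorem mainTheorem13:
  fixes G :: "'a pair_pre_digraph" and n p :: nat
  assumes "n = 2 * p + 1" and "n \<ge> 3"
    and "pair_graph G"
    and "Digraph_Component.connected (with_proj G)"
    and "card (pverts G) = n"
    and "\<not> (\<exists>u v w. suspended_path G u v w)"
    and "kernel_dim (randic_matrix G) \<ge> 1"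
  shows "randic_energy G < randic_energy (sun p)"
proof -
  interpret pair_graph G by fact
  have p: "p \<ge> 1" and n: "card (pverts G) \<ge> 3" using assms(1,2,5) by simp_all
  have "mat_trace (randic_matrix G ^\<^sub>m 2) \<le> real (card (pverts G)) / 2"
    by (rule randic_trace_2_le) (rule no_suspended_path_degree_sum[OF assms(4) n assms(6)])
  from randic_energy_le[OF this assms(7)]
  have "randic_energy G \<le> (4 * real p + 1) / (2 * sqrt 2)"
    by (simp add: assms(1,5) add.commute)
  also have "\<dots> = sqrt 2 * real p + sqrt 2 / 4"
    by (simp add: field_simps)
  also have "\<dots> < sqrt 2 * real p + 2 - sqrt 2"
  proof -
    have "sqrt 2 < 8 / 5" by (rule real_less_lsqrt) (simp_all add: power2_eq_square)
    then show ?thesis by simp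
  qed
  also have "\<dots> \<le> randic_energy (sun p)" by (rule randic_energy_sun_ge[OF p])
  finally show ?thesis .
qed

end
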